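(* Let $n\in\mathbb{N}$ and $T\in\mathbb{B}(\mathcal{H})$. Consider the following conditions: (i) $T^n$ is normal. (ii) $T^n$ is quasinormal. (iii) $T$ is $n$-power quasinormal. Then (i) implies (ii) and (iii). Moreover, if $\ker (T^\ast)^n\subseteq\ker T^n$, then the three conditions are equivalent. In particular, if $\mathcal{H}$ is finite-dimensional, the kernel inclusion $\ker (T^\ast)^n\subseteq\ker T^n$ is automatically satisfied whenever any one of (i)--(iii) holds.
   Context: $\mathbb{N}$ denotes the positive integers. $\mathbb{B}(\mathcal{H})$ is the algebra of bounded linear operators on a complex Hilbert space $\mathcal{H}$. Write $[S,T]=ST-TS$. An operator $T$ is normal if $[T,T^*]=0$, quasinormal if $[T,T^*T]=0$, and $n$-power quasinormal if $[T^n,T^*T]=0$. *)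

theory Defs
  imports "HOL-Analysis.Analysis"
begin

class scaleC = scaleR +
  fixes scaleC :: "complex \<Rightarrow> 'a \<Rightarrow> 'a" (infixr "*\<^sub>C" 75)

class complex_vector = scaleC + ab_group_add +
  assumes scaleC_add_right: "a *\<^sub>C (x + y) = a *\<^sub>C x + a *\<^sub>C y"
    and scaleC_add_left: "(a + b) *\<^sub>C x = a *\<^sub>C x + b *\<^sub>C x"
    and scaleC_scaleC: "a *\<^sub>C b *\<^sub>C x = (a * b) *\<^sub>C x"
    and scaleC_one: "1 *\<^sub>C x = x"
    and scaleR_scaleC: "r *\<^sub>R x = complex_of_real r *\<^sub>C x"

(* The inner product is linear in the first and conjugate-linear in the second
   argument. *)
class complex_inner = complex_vector + real_normed_vector +
  fixes cinner :: "'a \<Rightarrow> 'a \<Rightarrow> complex"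
  assumes cinner_commute: "cinner x y = cnj (cinner y x)"
    and cinner_add_left: "cinner (x + y) z = cinner x z + cinner y z"
    and cinner_scaleC_left: "cinner (c *\<^sub>C x) y = c * cinner x y"
    and cinner_ge_zero: "0 \<le> Re (cinner x x)"
    and cinner_eq_zero_iff: "cinner x x = 0 \<longleftrightarrow> x = 0"
    and norm_eq_sqrt_cinner: "norm x = sqrt (Re (cinner x x))"

class chilbert_space = complex_inner + complete_space

instantiation complex :: chilbert_space
begin

definition scaleC_complex :: "complex \<Rightarrow> complex \<Rightarrow> complex" where
  "scaleC_complex c x = c * x"

definition cinner_complex :: "complex \<Rightarrow> complex \<Rightarrow> complex" where
  "cinner_complex x y = x * cnj y"

instance
proof
  fix x :: complex
  show "norm x = sqrt (Re (cinner x x))"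
    by (simp add: cinner_complex_def cmod_def power2_eq_square)
qed (auto simp: scaleC_complex_def cinner_complex_def algebra_simps scaleR_conv_of_real)

end

global_interpretation complex_vector:
  vector_space "scaleC :: complex \<Rightarrow> 'a \<Rightarrow> 'a::complex_vector"
  by unfold_locales
    (simp_all add: scaleC_add_right scaleC_add_left scaleC_scaleC scaleC_one)

definition bounded_clinear :: "('a::complex_inner \<Rightarrow> 'b::complex_inner) \<Rightarrow> bool" where
  "bounded_clinear T \<longleftrightarrow> bounded_linear T \<and> (\<forall>c x. T (c *\<^sub>C x) = c *\<^sub>C T x)"

definition cadjoint :: "('a::chilbert_space \<Rightarrow> 'a) \<Rightarrow> 'a \<Rightarrow> 'a" where
  "cadjoint T = (THE S. \<forall>x y. cinner (T x) y = cinner x (S y))"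

definition commutator :: "('a::ab_group_add \<Rightarrow> 'a) \<Rightarrow> ('a \<Rightarrow> 'a) \<Rightarrow> 'a \<Rightarrow> 'a" where
  "commutator S T = (\<lambda>x. S (T x) - T (S x))"

definition normal_op :: "('a::chilbert_space \<Rightarrow> 'a) \<Rightarrow> bool" where
  "normal_op T \<longleftrightarrow> commutator T (cadjoint T) = (\<lambda>_. 0)"

definition quasinormal_op :: "('a::chilbert_space \<Rightarrow> 'a) \<Rightarrow> bool" where
  "quasinormal_op T \<longleftrightarrow> commutator T (cadjoint T \<circ> T) = (\<lambda>_. 0)"

definition power_quasinormal_op :: "nat \<Rightarrow> ('a::chilbert_space \<Rightarrow> 'a) \<Rightarrow> bool" where
  "power_quasinormal_op n T \<longleftrightarrow> commutator (T ^^ n) (cadjoint T \<circ> T) = (\<lambda>_. 0)"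

definition op_ker :: "('a::zero \<Rightarrow> 'a) \<Rightarrow> 'a set" where
  "op_ker T = {x. T x = 0}"

lemma cinner_add_right: "cinner x (y + z) = cinner x y + cinner x (z::'a::complex_inner)"
  by (subst (1 2 3) cinner_commute) (simp add: cinner_add_left)

lemma cinner_scaleC_right: "cinner x (c *\<^sub>C y) = cnj c * cinner x (y::'a::complex_inner)"
  by (subst (1 2) cinner_commute) (simp add: cinner_scaleC_left)

lemma cinner_diff_left: "cinner (x - y) z = cinner x z - cinner y (z::'a::complex_inner)"
  using cinner_add_left[of "x - y" y z] by simp

lemma cinner_diff_right: "cinner x (y - z) = cinner x y - cinner x (z::'a::complex_inner)"
  using cinner_add_right[of x "y - z" z] by simp

lemma cinner_scaleR_left: "cinner (r *\<^sub>R x) y = r * cinner x (y::'a::complex_inner)"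
  by (simp add: scaleR_scaleC cinner_scaleC_left)

lemma cinner_scaleR_right: "cinner x (r *\<^sub>R y) = r * cinner x (y::'a::complex_inner)"
  by (simp add: scaleR_scaleC cinner_scaleC_right)

lemma power2_norm_cinner: "(norm x)\<^sup>2 = Re (cinner x (x::'a::complex_inner))"
  by (simp add: norm_eq_sqrt_cinner cinner_ge_zero)

lemma Re_cinner_commute: "Re (cinner x y) = Re (cinner y (x::'a::complex_inner))"
  by (subst cinner_commute) simp

lemma norm_add_square:
  "(norm (x + y))\<^sup>2 = (norm x)\<^sup>2 + 2 * Re (cinner x y) + (norm (y::'a::complex_inner))\<^sup>2"
  using Re_cinner_commute[of x y]
  by (simp add: power2_norm_cinner cinner_add_left cinner_add_right)

lemma norm_diff_square:
  "(norm (x - y))\<^sup>2 = (norm x)\<^sup>2 - 2 * Re (cinner x y) + (norm (y::'a::complex_inner))\<^sup>2"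
  using Re_cinner_commute[of x y]
  by (simp add: power2_norm_cinner cinner_diff_left cinner_diff_right)

lemma cinner_right_unique:
  fixes u v :: "'a::complex_inner"
  assumes "\<And>x. cinner x u = cinner x v"
  shows "u = v"
  using assms[of "u - v"] cinner_eq_zero_iff[of "u - v"] by (simp add: cinner_diff_right)

lemma quadratic_nonneg_imp_zero:
  fixes a b :: real
  assumes "\<And>t. 0 \<le> t * a + t\<^sup>2 * b"
  shows "a = 0"
proof (rule ccontr)
  assume "a \<noteq> 0"
  define c where "c = \<bar>b\<bar> + 1"
  have c: "0 < c" and b: "b \<le> c - 1" by (auto simp: c_def)
  define t where "t = - a / c"
  have "t * a + t\<^sup>2 * b \<le> t * a + t\<^sup>2 * (c - 1)" using b by (simp add: mult_left_mono)
  also have "\<dots> = - (a\<^sup>2 / c\<^sup>2)"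
    using c by (simp add: t_def field_simps power2_eq_square)
  also have "\<dots> < 0" using c \<open>a \<noteq> 0\<close> by simp
  finally show False using assms[of t] by linarith
qed

lemma riesz_representation_real:
  fixes g :: "'a::chilbert_space \<Rightarrow> real"
  assumes "bounded_linear g"
  shows "\<exists>u. \<forall>x. g x = Re (cinner x u)"
proof -
  interpret g: bounded_linear g by fact
  define J where "J x = (norm x)\<^sup>2 - 2 * g x" for x
  obtain K where K: "\<And>x. norm (g x) \<le> norm x * K" using g.bounded by blast
  have J_ge: "- K\<^sup>2 \<le> J x" for x
  proof -
    have "0 \<le> (norm x - K)\<^sup>2" by simp
    moreover have "g x \<le> norm x * K" using K[of x] by simp
    ultimately show ?thesis by (simp add: J_def power2_diff)
  qed
  define m where "m = Inf (range J)"
  have bdd: "bdd_below (range J)" by (rule bdd_belowI2) (rule J_ge)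
  have m_le: "m \<le> J x" for x unfolding m_def by (rule cInf_lower) (use bdd in auto)
  have "\<exists>x. J x < m + 1 / real (Suc k)" for k
  proof -
    have "Inf (range J) < m + 1 / real (Suc k)" by (simp add: m_def)
    then show ?thesis using cInf_lessD[of "range J"] by blast
  qed
  then obtain X where X: "\<And>k. J (X k) < m + 1 / real (Suc k)" by metis
  have para: "(norm (x - y))\<^sup>2 \<le> 2 * (J x - m) + 2 * (J y - m)" for x y
  proof -
    have h: "(norm ((1/2) *\<^sub>R (x + y)))\<^sup>2 = (norm (x + y))\<^sup>2 / 4"
      by (simp add: power_divide)
    have gs: "g ((1/2) *\<^sub>R (x + y)) = (g x + g y) / 2"
      by (simp only: g.scaleR g.add) simp
    have "4 * m \<le> (norm (x + y))\<^sup>2 - 4 * (g x + g y)"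
      using m_le[of "(1/2) *\<^sub>R (x + y)"] unfolding J_def h gs by argo
    then show ?thesis unfolding J_def norm_add_square norm_diff_square by simp
  qed
  have "Cauchy X"
  proof (rule CauchyI)
    fix e :: real assume e: "0 < e"
    then obtain N where N: "1 / real (Suc N) < e\<^sup>2 / 4"
      using nat_approx_posE[of "e\<^sup>2 / 4"] by auto
    have "norm (X i - X j) < e" if "N \<le> i" "N \<le> j" for i j
    proof -
      have *: "J (X k) - m < e\<^sup>2 / 4" if "N \<le> k" for k
      proof -
        have "1 / real (Suc k) \<le> 1 / real (Suc N)" using that by (simp add: frac_le)
        then show ?thesis using X[of k] N by linarith
      qed
      have "(norm (X i - X j))\<^sup>2 < e\<^sup>2"
        using para[of "X i" "X j"] *[OF that(1)] *[OF that(2)] by argo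
      then show ?thesis using e by (simp add: power_less_imp_less_base)
    qed
    then show "\<exists>M. \<forall>i\<ge>M. \<forall>j\<ge>M. norm (X i - X j) < e" by blast
  qed
  then obtain u where u: "X \<longlonglongrightarrow> u" using Cauchy_convergent convergent_def by blast
  have "(\<lambda>k. J (X k)) \<longlonglongrightarrow> J u"
    unfolding J_def by (intro tendsto_intros u g.tendsto)
  moreover have "(\<lambda>k. m + 1 / real (Suc k)) \<longlonglongrightarrow> m + 0"
    by (intro tendsto_intros LIMSEQ_Suc[OF lim_1_over_n])
  ultimately have "J u \<le> m + 0"
    by (rule LIMSEQ_le) (use X in \<open>auto intro: less_imp_le\<close>)
  then have Jmin: "J u \<le> J x" for x using m_le[of x] by simp
  have "g x = Re (cinner x u)" for x
  proof -
    have "0 \<le> t * (2 * Re (cinner u x) - 2 * g x) + t\<^sup>2 * (norm x)\<^sup>2" for t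
    proof -
      have "J (u + t *\<^sub>R x) - J u
          = t * (2 * Re (cinner u x) - 2 * g x) + t\<^sup>2 * (norm x)\<^sup>2"
        unfolding J_def norm_add_square
        by (simp add: cinner_scaleR_right g.add g.scaleR algebra_simps power_mult_distrib)
      then show ?thesis using Jmin[of "u + t *\<^sub>R x"] by linarith
    qed
    from quadratic_nonneg_imp_zero[OF this] show ?thesis
      by (simp add: Re_cinner_commute[of x u])
  qed
  then show ?thesis by blast
qed

lemma riesz_representation:
  fixes f :: "'a::chilbert_space \<Rightarrow> complex"
  assumes "bounded_clinear f"
  shows "\<exists>u. \<forall>x. f x = cinner x u"
proof -
  have bl: "bounded_linear f" and sc: "\<And>c x. f (c *\<^sub>C x) = c * f x"
    using assms by (auto simp: bounded_clinear_def scaleC_complex_def)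
  obtain u where u: "\<And>x. Re (f x) = Re (cinner x u)"
    using riesz_representation_real[OF bounded_linear_compose[OF bounded_linear_Re bl]] by blast
  have "f x = cinner x u" for x
    using u[of x] u[of "\<i> *\<^sub>C x"] by (simp add: sc cinner_scaleC_left complex_eq_iff)
  then show ?thesis by blast
qed

lemma cauchy_schwarz_Re: "\<bar>Re (cinner x y)\<bar> \<le> norm x * norm (y::'a::complex_inner)"
proof -
  have "(norm (x + y))\<^sup>2 \<le> (norm x + norm y)\<^sup>2" "(norm (x - y))\<^sup>2 \<le> (norm x + norm y)\<^sup>2"
    by (simp_all add: power_mono norm_triangle_ineq norm_triangle_ineq4)
  then show ?thesis
    unfolding norm_add_square norm_diff_square by (simp add: power2_sum abs_le_iff)
qed

lemma norm_cinner_le: "norm (cinner x y) \<le> 2 * (norm x * norm (y::'a::complex_inner))"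
proof -
  have "norm (\<i> *\<^sub>C x) = norm x"
    by (simp add: norm_eq_sqrt_cinner cinner_scaleC_left cinner_scaleC_right)
  then have "\<bar>Im (cinner x y)\<bar> \<le> norm x * norm y"
    using cauchy_schwarz_Re[of "\<i> *\<^sub>C x" y] by (simp add: cinner_scaleC_left)
  then show ?thesis using cauchy_schwarz_Re[of x y] cmod_le[of "cinner x y"] by linarith
qed

(* The description defining cadjoint denotes whenever T is bounded. *)
lemma cinner_cadjoint:
  fixes T :: "'a::chilbert_space \<Rightarrow> 'a"
  assumes "bounded_clinear T"
  shows "cinner (T x) y = cinner x (cadjoint T y)"
proof -
  have bl: "bounded_linear T" and sc: "\<And>c x. T (c *\<^sub>C x) = c *\<^sub>C T x"
    using assms by (auto simp: bounded_clinear_def)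
  interpret T: bounded_linear T by (rule bl)
  obtain K where K: "\<And>x. norm (T x) \<le> norm x * K" using T.bounded by blast
  have "bounded_clinear (\<lambda>x. cinner (T x) y)" for y
    unfolding bounded_clinear_def
  proof (intro conjI allI)
    show "bounded_linear (\<lambda>x. cinner (T x) y)"
    proof (rule bounded_linear_intro[where K = "2 * (K * norm y)"])
      fix x
      have "norm (T x) * norm y \<le> norm x * K * norm y" by (intro mult_right_mono K) simp
      then show "norm (cinner (T x) y) \<le> norm x * (2 * (K * norm y))"
        using norm_cinner_le[of "T x" y] by (simp add: mult_ac)
    qed (simp_all add: T.add T.scaleR cinner_add_left cinner_scaleR_left scaleR_conv_of_real)
  qed (simp add: sc cinner_scaleC_left scaleC_complex_def)
  then have "\<exists>u. \<forall>x. cinner (T x) y = cinner x u" for y by (rule riesz_representation)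
  then obtain S where S: "\<forall>x y. cinner (T x) y = cinner x (S y)" by metis
  moreover have "S' = S" if "\<forall>x y. cinner (T x) y = cinner x (S' y)" for S'
    using that S by (metis cinner_right_unique ext)
  ultimately have "\<forall>x y. cinner (T x) y = cinner x (cadjoint T y)"
    unfolding cadjoint_def by (rule theI)
  then show ?thesis by blast
qed

end

theory Submission
  imports Defs "HOL-Complex_Analysis.Cauchy_Integral_Formula"
begin

text \<open>
  Write \<open>N = T ^^ n\<close>, \<open>M = cadjoint N\<close> and \<open>S = cadjoint T\<close>.

  If \<open>N\<close> is normal, it is quasinormal by inspection. Since \<open>T\<close> commutes with \<open>N\<close>, Fuglede's theorem
  (\<open>fuglede\<close>) says that \<open>T\<close> commutes with \<open>M\<close>; taking adjoints, \<open>S\<close> commutes with \<open>N\<close>, so \<open>N\<close>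
  commutes with \<open>S T\<close>.

  For the converses under \<open>ker M \<subseteq> ker N\<close>, consider the self-adjoint commutator \<open>D = N M - M N\<close>. If
  \<open>D\<close> vanishes on the range of some power of \<open>N\<close>, the kernel inclusion forces \<open>D = 0\<close>
  (\<open>normal_op_if_commutator_vanishes_on_range\<close>). Quasinormality of \<open>N\<close> says \<open>D N = 0\<close>. If \<open>T\<close> is
  \<open>n\<close>-power quasinormal, then \<open>N S = S N\<close> holds on the range of \<open>T\<close>, hence on that of \<open>N\<close>, and
  by induction \<open>N\<close> commutes with \<open>S ^^ j\<close> on the range of \<open>N ^^ j\<close>; at \<open>j = n\<close> this is
  \<open>D (N ^^ n) = 0\<close>.

  In finite dimension, let \<open>T\<close> be \<open>n\<close>-power quasinormal. Then \<open>T\<close> is injective on the range of \<open>N\<close>,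
  so that \<open>N\<close> maps its range onto itself. As \<open>S N N = N S N\<close>, the range of \<open>N\<close> is invariant under
  \<open>S\<close>, hence under \<open>M\<close>. For \<open>M x = 0\<close> one may then write \<open>M N x = N w\<close> and compute
  \<open>cinner (N x) (N x) = cinner x (N w) = cinner (M x) w = 0\<close>. Quasinormality of \<open>N\<close> is the case
  \<open>n = 1\<close> for \<open>N\<close> in place of \<open>T\<close>, and a normal operator has the same kernel as its adjoint.
\<close>

section \<open>Bounded operators and their adjoints\<close>

lemma bounded_clinearD:
  assumes "bounded_clinear T"
  shows bounded_clinear_add: "T (x + y) = T x + T y"
    and bounded_clinear_diff: "T (x - y) = T x - T y"
    and bounded_clinear_scaleC: "T (c *\<^sub>C x) = c *\<^sub>C T x"
    and bounded_clinear_scaleR: "T (r *\<^sub>R x) = r *\<^sub>R T x"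
    and bounded_clinear_zero: "T 0 = 0"
    and bounded_clinear_bound: "\<exists>K\<ge>0. \<forall>x. norm (T x) \<le> K * norm x"
proof -
  have bl: "bounded_linear T" and "\<And>c x. T (c *\<^sub>C x) = c *\<^sub>C T x"
    using assms by (auto simp: bounded_clinear_def)
  then show "T (c *\<^sub>C x) = c *\<^sub>C T x" by blast
  interpret bounded_linear T by (rule bl)
  show "T (x + y) = T x + T y" "T (x - y) = T x - T y" "T (r *\<^sub>R x) = r *\<^sub>R T x" "T 0 = 0"
    by (simp_all add: add diff scaleR zero)
  show "\<exists>K\<ge>0. \<forall>x. norm (T x) \<le> K * norm x"
    using nonneg_bounded by (auto simp: mult.commute)
qed

lemma cinner_zero: "cinner 0 x = 0" "cinner x 0 = 0" for x :: "'a::complex_inner"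
  using cinner_diff_left[of x x x] cinner_diff_right[of x x x] by simp_all

lemma norm_scaleC: "norm (c *\<^sub>C x) = cmod c * norm (x :: 'a::complex_inner)"
proof -
  have "cinner (c *\<^sub>C x) (c *\<^sub>C x) = (c * cnj c) * cinner x x"
    by (simp add: cinner_scaleC_left cinner_scaleC_right)
  also have "\<dots> = of_real ((cmod c)\<^sup>2) * cinner x x"
    by (simp only: complex_norm_square)
  finally have "Re (cinner (c *\<^sub>C x) (c *\<^sub>C x)) = (cmod c)\<^sup>2 * Re (cinner x x)"
    by (simp del: of_real_power)
  then show ?thesis
    by (simp add: norm_eq_sqrt_cinner[of x] norm_eq_sqrt_cinner[of "c *\<^sub>C x"] real_sqrt_mult)
qed

lemma cadjoint_eqI:
  assumes "\<And>x y. cinner (T x) y = cinner x (S y)"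
  shows "cadjoint T = S"
  unfolding cadjoint_def
proof (rule the_equality)
  show "\<forall>x y. cinner (T x) y = cinner x (S y)" using assms by blast
next
  fix S' assume "\<forall>x y. cinner (T x) y = cinner x (S' y)"
  then show "S' = S" using assms by (metis cinner_right_unique ext)
qed

lemma cinner_cadjoint_left:
  assumes "bounded_clinear T"
  shows "cinner (cadjoint T x) y = cinner x (T y)"
  by (metis cinner_cadjoint[OF assms] cinner_commute)

lemma bounded_clinear_cadjoint:
  assumes T: "bounded_clinear T"
  shows "bounded_clinear (cadjoint T)"
proof -
  let ?S = "cadjoint T"
  note adj = cinner_cadjoint[OF T, symmetric]
  have sc: "?S (c *\<^sub>C x) = c *\<^sub>C ?S x" for c x
    by (rule cinner_right_unique) (simp add: adj cinner_scaleC_right)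
  obtain K where K: "K \<ge> 0" "\<And>x. norm (T x) \<le> K * norm x"
    using bounded_clinear_bound[OF T] by blast
  have "bounded_linear ?S"
  proof (rule bounded_linear_intro[where K = K])
    fix x y :: 'a and r :: real
    show "?S (x + y) = ?S x + ?S y"
      by (rule cinner_right_unique) (simp add: adj cinner_add_right)
    show "?S (r *\<^sub>R x) = r *\<^sub>R ?S x" by (simp add: scaleR_scaleC sc)
    have "(norm (?S x))\<^sup>2 = Re (cinner (T (?S x)) x)"
      by (simp add: power2_norm_cinner adj)
    also have "\<dots> \<le> norm (T (?S x)) * norm x" using cauchy_schwarz_Re[of "T (?S x)" x] by simp
    also have "\<dots> \<le> K * norm (?S x) * norm x" using K by (simp add: mult_right_mono)
    finally show "norm (?S x) \<le> norm x * K"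
      by (cases "norm (?S x) = 0") (use K in \<open>auto simp: power2_eq_square mult_ac\<close>)
  qed
  with sc show ?thesis by (simp add: bounded_clinear_def)
qed

lemma bounded_clinear_funpow:
  fixes T :: "'a::complex_inner \<Rightarrow> 'a"
  assumes "bounded_clinear T"
  shows "bounded_clinear (T ^^ n)"
proof (induction n)
  case 0
  have "T ^^ 0 = (\<lambda>x. x)" by (rule ext) simp
  then show ?case by (simp add: bounded_clinear_def del: funpow.simps)
next
  case (Suc n)
  then show ?case
    using assms bounded_linear_compose[of T "T ^^ n"] by (simp add: bounded_clinear_def o_def)
qed

lemma cadjoint_funpow:
  assumes T: "bounded_clinear T"
  shows "cadjoint (T ^^ n) = cadjoint T ^^ n"
proof (rule cadjoint_eqI)
  show "cinner ((T ^^ n) x) y = cinner x ((cadjoint T ^^ n) y)" for x y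
    by (induction n arbitrary: x)
      (simp_all add: funpow_swap1[of T] cinner_cadjoint[OF T])
qed

section \<open>Fuglede's theorem\<close>

text \<open>
  The proof is a finite-step version of Rosenblum's argument. With \<open>M = cadjoint N\<close>, Rosenblum applies
  Liouville's theorem to the entire function \<open>exp(l M) T exp(-l M)\<close> of \<open>l\<close>, which is bounded because
  it equals the conjugate of \<open>T\<close> by the exponential of the skew-adjoint operator
  \<open>Z = l M - cnj l N\<close>. Here the exponential of the derivation \<open>X \<mapsto> M X - X M\<close> is replaced by the
  power \<open>(1 + (l/m) [M, \<cdot>]) ^ m\<close>, a polynomial in \<open>l\<close> whose linear coefficient at \<open>T\<close> is \<open>[M, T]\<close>.
  With \<open>m = j\<^sup>2\<close> these polynomials are bounded on \<open>cmod l = j\<close> uniformly in \<open>j\<close>, and Cauchy's estimate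
  gives \<open>[M, T] = 0\<close>.
\<close>

text \<open>
  For skew-adjoint \<open>Z\<close>, one step \<open>X \<mapsto> X + s [Z, X]\<close> increases a bound on \<open>X\<close> only to second order
  in \<open>s\<close>: it differs from \<open>(1 + s Z) X (1 - s Z)\<close> by \<open>s\<^sup>2 Z X Z\<close>, and each outer factor has norm at
  most \<open>sqrt (1 + s\<^sup>2 c\<^sup>2)\<close>, since \<open>Z v\<close> is orthogonal to \<open>v\<close> in the real inner product.
\<close>

lemma norm_commutator_perturbation_le:
  fixes X Z :: "'a::complex_inner \<Rightarrow> 'a"
  assumes X: "bounded_clinear X" and skew: "\<And>v. Re (cinner (Z v) v) = 0"
    and c: "\<And>v. norm (Z v) \<le> c * norm v" "c \<ge> 0"
    and K: "\<And>v. norm (X v) \<le> K * norm v" "K \<ge> 0"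
    and diff: "\<And>u v. Z (u - v) = Z u - Z v" and scale: "\<And>r v. Z (r *\<^sub>R v) = r *\<^sub>R Z v"
  shows "norm (X v + s *\<^sub>R (Z (X v) - X (Z v))) \<le> (1 + 2 * s\<^sup>2 * c\<^sup>2) * K * norm v"
proof -
  have factor: "norm (u + t *\<^sub>R Z u) \<le> sqrt (1 + t\<^sup>2 * c\<^sup>2) * norm u" for u t
  proof -
    have "Re (cinner u (Z u)) = 0" using skew[of u] Re_cinner_commute[of u "Z u"] by simp
    then have "(norm (u + t *\<^sub>R Z u))\<^sup>2 = (norm u)\<^sup>2 + t\<^sup>2 * (norm (Z u))\<^sup>2"
      by (simp add: norm_add_square cinner_scaleR_right power_mult_distrib)
    also have "\<dots> \<le> (norm u)\<^sup>2 + t\<^sup>2 * (c * norm u)\<^sup>2"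
      using c by (intro add_left_mono mult_left_mono power_mono) auto
    also have "\<dots> = (sqrt (1 + t\<^sup>2 * c\<^sup>2) * norm u)\<^sup>2"
      by (simp add: power_mult_distrib algebra_simps)
    finally show ?thesis using power2_le_imp_le
      by (smt (verit) c(2) norm_ge_zero real_sqrt_ge_zero zero_le_mult_iff zero_le_power2)
  qed
  define w where "w = v + (- s) *\<^sub>R Z v"
  define R where "R = sqrt (1 + s\<^sup>2 * c\<^sup>2)"
  have R: "R \<ge> 0" "R * R = 1 + s\<^sup>2 * c\<^sup>2" by (simp_all add: R_def)
  have "norm (X w + s *\<^sub>R Z (X w)) \<le> R * norm (X w)"
    unfolding R_def by (rule factor)
  also have "\<dots> \<le> R * (K * (R * norm v))"
    using factor[of v "- s"] R K
    by (intro mult_left_mono order_trans[OF K(1)]) (auto simp: w_def R_def)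
  also have "\<dots> = (1 + s\<^sup>2 * c\<^sup>2) * K * norm v" by (simp flip: R(2))
  finally have 1: "norm (X w + s *\<^sub>R Z (X w)) \<le> (1 + s\<^sup>2 * c\<^sup>2) * K * norm v" .
  have "norm (Z (X (Z v))) \<le> c * (K * (c * norm v))"
    using c K by (meson mult_left_mono order_trans)
  then have "s\<^sup>2 * norm (Z (X (Z v))) \<le> s\<^sup>2 * (c * (K * (c * norm v)))"
    by (intro mult_left_mono) auto
  then have 2: "norm ((s\<^sup>2) *\<^sub>R Z (X (Z v))) \<le> s\<^sup>2 * c\<^sup>2 * K * norm v"
    by (simp add: power2_eq_square mult_ac)
  have "X v + s *\<^sub>R (Z (X v) - X (Z v)) = (X w + s *\<^sub>R Z (X w)) + (s\<^sup>2) *\<^sub>R Z (X (Z v))"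
    by (simp add: w_def bounded_clinearD[OF X] diff scale power2_eq_square algebra_simps)
  then show ?thesis
    using 1 2 norm_triangle_ineq[of "X w + s *\<^sub>R Z (X w)" "(s\<^sup>2) *\<^sub>R Z (X (Z v))"]
    by (simp add: algebra_simps)
qed

text \<open>
  The map \<open>1 + c [M, \<cdot>]\<close>, acting on operators; its \<open>m\<close>-fold iterate with \<open>c = l / m\<close> stands in for
  \<open>X \<mapsto> exp(l M) X exp(-l M)\<close>.
\<close>
definition ad_step :: "('a::complex_inner \<Rightarrow> 'a) \<Rightarrow> complex \<Rightarrow> ('a \<Rightarrow> 'a) \<Rightarrow> 'a \<Rightarrow> 'a" where
  "ad_step M c X = (\<lambda>x. X x + c *\<^sub>C commutator M X x)"

lemma bounded_clinear_ad_step: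
  assumes M: "bounded_clinear M" and X: "bounded_clinear X"
  shows "bounded_clinear (ad_step M c X)"
proof -
  have bl: "bounded_linear M" "bounded_linear X" using M X by (auto simp: bounded_clinear_def)
  have sc: "bounded_linear (\<lambda>x. c *\<^sub>C (x :: 'a))"
    by (rule bounded_linear_intro[where K = "cmod c"])
      (simp_all add: scaleC_add_right norm_scaleC scaleR_scaleC scaleC_scaleC mult.commute)
  have "bounded_linear (ad_step M c X)"
    unfolding ad_step_def commutator_def
    by (intro bounded_linear_add bounded_linear_sub bl
        bounded_linear_compose[OF sc] bounded_linear_compose[OF bl(1)] bounded_linear_compose[OF bl(2)])
  then show ?thesis
    by (simp add: bounded_clinear_def ad_step_def commutator_def bounded_clinearD[OF M]
        bounded_clinearD[OF X] scaleC_add_right complex_vector.scale_right_diff_distrib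
        scaleC_scaleC mult.commute)
qed

lemma ad_step_funpow_add:
  fixes M :: "'a::complex_inner \<Rightarrow> 'a"
  assumes M: "bounded_clinear M"
  shows "(ad_step M c ^^ j) (\<lambda>x. X x + d *\<^sub>C Y x)
    = (\<lambda>x. (ad_step M c ^^ j) X x + d *\<^sub>C (ad_step M c ^^ j) Y x)"
proof (induction j)
  case (Suc j)
  then show ?case
    by (simp add: ad_step_def commutator_def bounded_clinearD[OF M] fun_eq_iff
        scaleC_add_right complex_vector.scale_right_diff_distrib scaleC_scaleC mult.commute)
qed simp

text \<open>
  Matrix coefficients of the iterates are entire in \<open>l\<close>. Both claims go by induction on \<open>j\<close>, peeling
  off the innermost step and using additivity of the remaining ones.
\<close>
lemma ad_step_funpow_has_field_derivative:
  fixes M X :: "'a::complex_inner \<Rightarrow> 'a" and x y :: 'a and m :: nat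
  assumes M: "bounded_clinear M"
  defines "q \<equiv> \<lambda>j X l. cinner ((ad_step M (l / of_nat m) ^^ j) X x) y"
  shows "q j X holomorphic_on UNIV"
    and "(q j X has_field_derivative of_nat j / of_nat m * cinner (commutator M X x) y) (at 0)"
proof -
  have step: "q (Suc j) X = (\<lambda>l. q j X l + l / of_nat m * q j (commutator M X) l)" for j X
    unfolding q_def funpow_Suc_right o_def ad_step_def[of _ _ X] ad_step_funpow_add[OF M]
    by (simp add: cinner_add_left cinner_scaleC_left)
  have id: "ad_step M 0 = (\<lambda>X. X)" by (simp add: ad_step_def fun_eq_iff)
  have q0: "q j X 0 = cinner (X x) y" for j X
    unfolding q_def by (induction j arbitrary: X) (simp_all add: id)
  have hol: "q j X holomorphic_on UNIV" for j X
  proof (induction j arbitrary: X)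
    case 0
    then show ?case by (simp add: q_def)
  next
    case (Suc j)
    then show ?case unfolding step
      by (cases "m = 0") (auto intro!: holomorphic_intros)
  qed
  then show "q j X holomorphic_on UNIV" .
  show "(q j X has_field_derivative of_nat j / of_nat m * cinner (commutator M X x) y) (at 0)"
  proof (induction j)
    case 0
    then show ?case by (simp add: q_def)
  next
    case (Suc j)
    obtain D where "(q j (commutator M X) has_field_derivative D) (at 0)"
      using hol[of j "commutator M X"] by (auto simp: holomorphic_on_def field_differentiable_def)
    then have "((\<lambda>l. q j X l + l * inverse (of_nat m) * q j (commutator M X) l) has_field_derivative
      of_nat j / of_nat m * cinner (commutator M X x) y +
        (inverse (of_nat m) * q j (commutator M X) 0 + D * (0 * inverse (of_nat m)))) (at 0)"
      by (auto intro!: derivative_eq_intros Suc)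
    then show ?case unfolding step q0
      by (simp add: field_simps add_divide_distrib)
  qed
qed

theorem fuglede:
  fixes N T :: "'a::chilbert_space \<Rightarrow> 'a"
  assumes N: "bounded_clinear N" and normal: "normal_op N" and T: "bounded_clinear T"
    and comm: "\<And>x. N (T x) = T (N x)"
  shows "cadjoint N (T x) = T (cadjoint N x)"
proof -
  define M where "M = cadjoint N"
  have M: "bounded_clinear M" unfolding M_def by (rule bounded_clinear_cadjoint[OF N])
  have NM: "N (M x) = M (N x)" for x
    using fun_cong[OF normal[unfolded normal_op_def], of x] by (simp add: commutator_def M_def)
  obtain K1 K2 where K12: "K1 \<ge> 0" "\<And>x. norm (N x) \<le> K1 * norm x"
      "K2 \<ge> 0" "\<And>x. norm (M x) \<le> K2 * norm x"
    using bounded_clinear_bound[OF N] bounded_clinear_bound[OF M] by metis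
  obtain K where K: "K \<ge> 0" "\<And>x. norm (T x) \<le> K * norm x"
    using bounded_clinear_bound[OF T] by blast
  define k where "k = K1 + K2"
  \<comment> \<open>On operators commuting with \<open>N\<close>, the bracket with \<open>l M\<close> equals the bracket with the
    skew-adjoint \<open>Z = l M - cnj l N\<close>; and \<open>ad_step M\<close> preserves these operators because \<open>M\<close> commutes
    with \<open>N\<close>. This is the only use of normality.\<close>
  have step: "bounded_clinear (ad_step M (l / of_nat m) X) \<and>
      (\<forall>x. N (ad_step M (l / of_nat m) X x) = ad_step M (l / of_nat m) X (N x)) \<and>
      (\<forall>x. norm (ad_step M (l / of_nat m) X x)
         \<le> (1 + 2 * (1 / real m)\<^sup>2 * (cmod l * k)\<^sup>2) * L * norm x)"
    if X: "bounded_clinear X" "\<And>x. N (X x) = X (N x)" "\<And>x. norm (X x) \<le> L * norm x" "L \<ge> 0"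
    for X l L and m :: nat
  proof (intro conjI allI)
    show "bounded_clinear (ad_step M (l / of_nat m) X)" by (rule bounded_clinear_ad_step[OF M X(1)])
    show "N (ad_step M (l / of_nat m) X x) = ad_step M (l / of_nat m) X (N x)" for x
      by (simp add: ad_step_def commutator_def bounded_clinearD[OF N] NM X(2))
    fix x
    define Z where "Z v = l *\<^sub>C M v - cnj l *\<^sub>C N v" for v
    have Zl: "Z (u - v) = Z u - Z v" "Z (r *\<^sub>R v) = r *\<^sub>R Z v" for u v r
      by (simp_all add: Z_def bounded_clinearD[OF N] bounded_clinearD[OF M] scaleR_scaleC
          complex_vector.scale_right_diff_distrib scaleC_scaleC mult.commute)
    have skew: "Re (cinner (Z v) v) = 0" for v
    proof -
      have "cinner (M v) v = cnj (cinner (N v) v)"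
        unfolding M_def cinner_cadjoint_left[OF N] by (rule cinner_commute)
      then have "cinner (Z v) v = cnj (cnj l * cinner (N v) v) - cnj l * cinner (N v) v"
        by (simp add: Z_def cinner_diff_left cinner_scaleC_left)
      then show ?thesis by simp
    qed
    have Zb: "norm (Z v) \<le> cmod l * k * norm v" for v
    proof -
      have "norm (Z v) \<le> cmod l * norm (M v) + cmod l * norm (N v)"
        unfolding Z_def by (metis norm_triangle_ineq4 norm_scaleC complex_mod_cnj)
      also have "\<dots> \<le> cmod l * (K2 * norm v) + cmod l * (K1 * norm v)"
        by (intro add_mono mult_left_mono K12) auto
      finally show ?thesis by (simp add: k_def algebra_simps)
    qed
    have k0: "0 \<le> cmod l * k" using K12 by (simp add: k_def)
    have sr: "(1 / real m) *\<^sub>R u = (1 / of_nat m) *\<^sub>C u" for u :: 'a by (simp add: scaleR_scaleC)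
    have "ad_step M (l / of_nat m) X x = X x + (1 / real m) *\<^sub>R (Z (X x) - X (Z x))"
      unfolding sr
      by (simp add: ad_step_def commutator_def Z_def bounded_clinearD[OF X(1)] X(2)
          complex_vector.scale_right_diff_distrib scaleC_scaleC)
    then show "norm (ad_step M (l / of_nat m) X x)
         \<le> (1 + 2 * (1 / real m)\<^sup>2 * (cmod l * k)\<^sup>2) * L * norm x"
      using norm_commutator_perturbation_le[OF X(1) skew Zb k0 X(3,4) Zl] by simp
  qed
  have iter: "norm ((ad_step M (l / of_nat m) ^^ j) T x)
      \<le> (1 + 2 * (1 / real m)\<^sup>2 * (cmod l * k)\<^sup>2) ^ j * K * norm x" for l j x and m :: nat
  proof -
    let ?a = "1 + 2 * (1 / real m)\<^sup>2 * (cmod l * k)\<^sup>2"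
    have "bounded_clinear ((ad_step M (l / of_nat m) ^^ j) T) \<and>
      (\<forall>x. N ((ad_step M (l / of_nat m) ^^ j) T x) = (ad_step M (l / of_nat m) ^^ j) T (N x)) \<and>
      (\<forall>x. norm ((ad_step M (l / of_nat m) ^^ j) T x) \<le> ?a ^ j * K * norm x)"
    proof (induction j)
      case 0
      then show ?case using T comm K by simp
    next
      case (Suc j)
      have "0 \<le> ?a ^ j * K" using K by simp
      with Suc step[where X = "(ad_step M (l / of_nat m) ^^ j) T" and L = "?a ^ j * K" and l = l and m = m]
      show ?case by (simp add: mult.assoc)
    qed
    then show ?thesis by blast
  qed
  have "cinner (commutator M T x) y = 0" for y
  proof -
    define B where "B = 2 * (exp (2 * k\<^sup>2) * K * norm x * norm y)"
    have est: "cmod (cinner (commutator M T x) y) \<le> B / real j" if j: "j > 0" for j :: nat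
    proof -
      \<comment> \<open>On the circle of radius \<open>j\<close> the growth factor is \<open>(1 + 2 j\<^sup>2 k\<^sup>2 / m\<^sup>2) ^ m\<close>;
        the choice \<open>m = j\<^sup>2\<close> turns it into \<open>(1 + 2 k\<^sup>2 / m) ^ m\<close>, bounded in \<open>j\<close>.\<close>
      define m where "m = j\<^sup>2"
      have m: "m > 0" using j by (simp add: m_def)
      define q where "q l = cinner ((ad_step M (l / of_nat m) ^^ m) T x) y" for l
      have hol: "q holomorphic_on UNIV"
        unfolding q_def by (rule ad_step_funpow_has_field_derivative(1)[OF M])
      have "(q has_field_derivative of_nat m / of_nat m * cinner (commutator M T x) y) (at 0)"
        unfolding q_def by (rule ad_step_funpow_has_field_derivative(2)[OF M])
      then have d: "deriv q 0 = cinner (commutator M T x) y" using m DERIV_imp_deriv by fastforce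
      have "norm ((deriv ^^ 1) q 0) \<le> fact 1 * B / real j ^ 1"
      proof (rule Cauchy_inequality)
        show "q holomorphic_on ball 0 (real j)" using hol holomorphic_on_subset by blast
        show "continuous_on (cball 0 (real j)) q"
          using hol holomorphic_on_imp_continuous_on holomorphic_on_subset by blast
        show "0 < real j" using j by simp
        fix l :: complex assume "norm (0 - l) = real j"
        then have l: "cmod l = real j" by simp
        have "2 * (1 / real m)\<^sup>2 * (cmod l * k)\<^sup>2 = (2 * k\<^sup>2) / real m"
          using j by (simp add: l m_def field_simps power2_eq_square)
        then have "(1 + 2 * (1 / real m)\<^sup>2 * (cmod l * k)\<^sup>2) ^ m \<le> exp (2 * k\<^sup>2)"
          using exp_ge_one_plus_x_over_n_power_n[of m "2 * k\<^sup>2"] m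
          by (smt (verit) of_nat_0_le_iff zero_le_power2)
        then have "(1 + 2 * (1 / real m)\<^sup>2 * (cmod l * k)\<^sup>2) ^ m * K * norm x \<le> exp (2 * k\<^sup>2) * K * norm x"
          using K by (intro mult_right_mono) auto
        then have "norm ((ad_step M (l / of_nat m) ^^ m) T x) \<le> exp (2 * k\<^sup>2) * K * norm x"
          using iter[where l = l and m = m and j = m and x = x] by linarith
        then have "norm ((ad_step M (l / of_nat m) ^^ m) T x) * norm y
            \<le> exp (2 * k\<^sup>2) * K * norm x * norm y"
          by (rule mult_right_mono) simp
        then show "norm (q l) \<le> B"
          unfolding q_def B_def using norm_cinner_le by (smt (verit))
      qed
      with d show ?thesis by simp
    qed
    have "(\<lambda>j. B / real j) \<longlonglongrightarrow> 0" by (rule lim_const_over_n)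
    then have "cmod (cinner (commutator M T x) y) \<le> 0"
      by (rule LIMSEQ_le_const) (use est in \<open>auto intro!: exI[of _ 1]\<close>)
    then show ?thesis by simp
  qed
  from this[of "commutator M T x"] show ?thesis
    by (simp add: cinner_eq_zero_iff commutator_def M_def)
qed

section \<open>Normality from the kernel inclusion\<close>

text \<open>
  With \<open>M = cadjoint N\<close> and \<open>D = N M - M N\<close>, the adjoint of \<open>D (N ^^ k) = 0\<close> is \<open>(M ^^ k) D = 0\<close>. The
  kernel inclusion makes the kernels of all positive powers of \<open>M\<close> equal to that of \<open>M\<close>, so
  \<open>M D = 0\<close> and then \<open>N D = 0\<close>. The adjoints of these give \<open>D N = D M = 0\<close>, whence \<open>D D = 0\<close>, and
  \<open>D = 0\<close> because \<open>D\<close> is self-adjoint.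
\<close>
lemma normal_op_if_commutator_vanishes_on_range:
  fixes N :: "'a::chilbert_space \<Rightarrow> 'a"
  assumes N: "bounded_clinear N" and ker: "op_ker (cadjoint N) \<subseteq> op_ker N"
    and vanish: "\<And>x. commutator N (cadjoint N) ((N ^^ k) x) = 0"
  shows "normal_op N"
proof -
  define M where "M = cadjoint N"
  define D where "D = commutator N M"
  have M: "bounded_clinear M" unfolding M_def by (rule bounded_clinear_cadjoint[OF N])
  note adj = cinner_cadjoint[OF N, folded M_def]
  note adj' = cinner_cadjoint_left[OF N, folded M_def]
  have kerMN: "N x = 0" if "M x = 0" for x
    using ker that by (auto simp: op_ker_def M_def)
  have D_diff: "D (u - v) = D u - D v" for u v
    by (simp add: D_def commutator_def bounded_clinearD[OF N] bounded_clinearD[OF M])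
  have D_self: "cinner (D u) v = cinner u (D v)" for u v
    by (simp add: D_def commutator_def cinner_diff_left cinner_diff_right adj adj')
  have kerpow: "M x = 0" if "(M ^^ j) x = 0" "j > 0" for j x
    using that
  proof (induction j)
    case (Suc j)
    show ?case
    proof (cases "j = 0")
      case False
      then obtain i where i: "j = Suc i" by (cases j) auto
      define z where "z = (M ^^ i) x"
      \<comment> \<open>\<open>M (M z) = 0\<close> gives \<open>N (M z) = 0\<close>, and \<open>N M\<close> has the same kernel as \<open>M\<close>.\<close>
      have "M (M z) = 0" using Suc.prems by (simp add: i z_def)
      then have "N (M z) = 0" by (rule kerMN)
      then have "cinner (M z) (M z) = 0" by (simp add: adj' cinner_zero)
      then have "(M ^^ j) x = 0" by (simp add: cinner_eq_zero_iff i z_def)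
      then show ?thesis using Suc.IH False by simp
    qed (use Suc in simp)
  qed simp
  have MkD: "(M ^^ k) (D x) = 0" for x
  proof (rule cinner_right_unique)
    fix z
    have "cinner z ((M ^^ k) (D x)) = cinner (D ((N ^^ k) z)) x"
      using cinner_cadjoint[OF bounded_clinear_funpow[OF N], of k z "D x"]
      by (simp add: cadjoint_funpow[OF N] M_def D_self)
    also have "\<dots> = cinner z 0"
      using vanish[of z] by (simp add: D_def M_def cinner_zero)
    finally show "cinner z ((M ^^ k) (D x)) = cinner z 0" .
  qed
  have MD: "M (D x) = 0" for x
    using MkD[of x] kerpow[of k "D x"] bounded_clinear_zero[OF M] by (cases "k = 0") auto
  then have ND: "N (D x) = 0" for x using kerMN by blast
  have DN: "D (N x) = 0" and DM: "D (M x) = 0" for x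
    by (rule cinner_right_unique,
        simp add: MD ND cinner_zero flip: D_self adj adj')+
  have "D x = 0" for x
  proof -
    have "D (D x) = D (N (M x)) - D (M (N x))"
      by (subst (2) D_def) (simp add: commutator_def D_diff)
    then have "cinner (D x) (D x) = cinner x 0" by (simp add: D_self DN DM)
    then show ?thesis by (simp add: cinner_eq_zero_iff cinner_zero)
  qed
  then show ?thesis by (simp add: normal_op_def D_def M_def fun_eq_iff)
qed

lemma normal_op_imp_quasinormal_op: "normal_op N \<Longrightarrow> quasinormal_op N"
  by (auto simp: normal_op_def quasinormal_op_def commutator_def fun_eq_iff)

lemma normal_op_if_quasinormal_op:
  fixes N :: "'a::chilbert_space \<Rightarrow> 'a"
  assumes "bounded_clinear N" and "op_ker (cadjoint N) \<subseteq> op_ker N" and "quasinormal_op N"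
  shows "normal_op N"
proof (rule normal_op_if_commutator_vanishes_on_range[OF assms(1,2)])
  show "commutator N (cadjoint N) ((N ^^ 1) x) = 0" for x
    using fun_cong[OF assms(3)[unfolded quasinormal_op_def], of x] by (simp add: commutator_def)
qed

lemma power_quasinormal_op_commute:
  assumes "power_quasinormal_op n T"
  shows "(T ^^ n) (cadjoint T (T x)) = cadjoint T ((T ^^ n) (T x))"
  using assms by (simp add: power_quasinormal_op_def commutator_def fun_eq_iff funpow_swap1)

lemma power_quasinormal_op_if_normal_op_funpow:
  assumes T: "bounded_clinear T" and normal: "normal_op (T ^^ n)"
  shows "power_quasinormal_op n T"
proof -
  define N where "N = T ^^ n"
  define S where "S = cadjoint T"
  have N: "bounded_clinear N" unfolding N_def by (rule bounded_clinear_funpow[OF T])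
  have NT: "N (T x) = T (N x)" for x by (simp add: N_def funpow_swap1)
  have MT: "cadjoint N (T x) = T (cadjoint N x)" for x
    by (rule fuglede[OF N _ T NT]) (use normal in \<open>simp add: N_def\<close>)
  have SN: "S (N x) = N (S x)" for x
  proof (rule cinner_right_unique)
    show "cinner z (S (N x)) = cinner z (N (S x))" for z
      by (simp only: S_def cinner_cadjoint[OF T, symmetric] cinner_cadjoint_left[OF N, symmetric] MT)
  qed
  then show ?thesis
    unfolding power_quasinormal_op_def N_def[symmetric] S_def[symmetric]
    by (simp add: commutator_def NT SN[symmetric])
qed

lemma normal_op_funpow_if_power_quasinormal_op:
  fixes T :: "'a::chilbert_space \<Rightarrow> 'a"
  assumes T: "bounded_clinear T" and n: "n \<ge> 1"
    and ker: "op_ker (cadjoint T ^^ n) \<subseteq> op_ker (T ^^ n)" and pq: "power_quasinormal_op n T"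
  shows "normal_op (T ^^ n)"
proof -
  define N where "N = T ^^ n"
  define S where "S = cadjoint T"
  have N: "bounded_clinear N" unfolding N_def by (rule bounded_clinear_funpow[OF T])
  have NS: "N (S (T x)) = S (N (T x))" for x
    using power_quasinormal_op_commute[OF pq] by (simp add: N_def S_def)
  \<comment> \<open>The range of \<open>N\<close> is contained in that of \<open>T\<close>, since \<open>n \<ge> 1\<close>.\<close>
  have NSN: "N (S (N x)) = S (N (N x))" for x
    using NS[of "(T ^^ (n - 1)) x"] n by (cases n) (auto simp: N_def)
  \<comment> \<open>Consequently \<open>S\<close> maps the range of \<open>N ^^ Suc j\<close> into that of \<open>N ^^ j\<close>.\<close>
  have pow: "S (N ((N ^^ j) x)) = (N ^^ j) (S (N x))" for j x
    by (induction j) (simp_all flip: NSN)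
  have comm: "N ((S ^^ j) ((N ^^ j) x)) = (S ^^ j) (N ((N ^^ j) x))" for j x
  proof (induction j arbitrary: x)
    case (Suc j)
    have "N ((S ^^ Suc j) ((N ^^ Suc j) x)) = N ((S ^^ j) ((N ^^ j) (S (N x))))"
      by (simp add: funpow_swap1 flip: pow)
    also have "\<dots> = (S ^^ j) (N (S (N ((N ^^ j) x))))" by (simp add: Suc pow)
    also have "\<dots> = (S ^^ Suc j) (N ((N ^^ Suc j) x))" by (simp add: NSN funpow_swap1[of S])
    finally show ?case .
  qed simp
  have adj: "cadjoint N = S ^^ n" by (simp add: N_def S_def cadjoint_funpow[OF T])
  have "normal_op N"
  proof (rule normal_op_if_commutator_vanishes_on_range[OF N])
    show "op_ker (cadjoint N) \<subseteq> op_ker N" using ker unfolding adj by (simp add: S_def N_def)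
    show "commutator N (cadjoint N) ((N ^^ n) x) = 0" for x
      using comm[of n x] by (simp add: commutator_def adj)
  qed
  then show ?thesis by (simp add: N_def)
qed

section \<open>Finite dimension\<close>

text \<open>
  A linear endomorphism whose kernel meets its range trivially maps its range onto itself.
\<close>
lemma range_subset_range_square:
  fixes f :: "'a::complex_vector \<Rightarrow> 'a"
  assumes fd: "finite_dimensional_vector_space (scaleC :: complex \<Rightarrow> 'a \<Rightarrow> 'a) B"
    and lin: "\<And>x y. f (x + y) = f x + f y" "\<And>c x. f (c *\<^sub>C x) = c *\<^sub>C f x"
    and ker: "\<And>x. f (f x) = 0 \<Longrightarrow> f x = 0"
  shows "\<exists>z. f x = f (f z)"
proof -
  interpret fd: finite_dimensional_vector_space "scaleC :: complex \<Rightarrow> 'a \<Rightarrow> 'a" B by (rule fd)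
  interpret p: finite_dimensional_vector_space_pair
    "scaleC :: complex \<Rightarrow> 'a \<Rightarrow> 'a" B "scaleC :: complex \<Rightarrow> 'a \<Rightarrow> 'a" B by unfold_locales
  interpret f: Vector_Spaces.linear scaleC scaleC f by unfold_locales (simp_all add: lin)
  have sub: "complex_vector.subspace (range f)"
    by (rule f.subspace_image) (rule complex_vector.subspace_UNIV)
  have "inj_on f (range f)"
  proof (rule inj_onI)
    fix u v assume uv: "u \<in> range f" "v \<in> range f" "f u = f v"
    then obtain w where w: "u - v = f w" using complex_vector.subspace_diff[OF sub] by blast
    have "f (f w) = 0" using uv by (simp add: f.diff flip: w)
    then show "u = v" using ker[of w] w by simp
  qed
  then have "complex_vector.dim (f ` range f) = complex_vector.dim (range f)"
    by (intro p.dim_image_eq f.linear_axioms)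
      (simp add: complex_vector.span_eq_iff[THEN iffD2, OF sub])
  then have "f ` range f = range f"
    by (intro fd.subspace_dim_equal f.subspace_image sub) auto
  then have "f x \<in> f ` range f" by blast
  then show ?thesis by blast
qed

lemma op_ker_cadjoint_eq_if_normal_op:
  fixes N :: "'a::chilbert_space \<Rightarrow> 'a"
  assumes N: "bounded_clinear N" and normal: "normal_op N"
  shows "op_ker (cadjoint N) = op_ker N"
proof -
  have "N (cadjoint N x) = cadjoint N (N x)" for x
    using fun_cong[OF normal[unfolded normal_op_def], of x] by (simp add: commutator_def)
  then have "cinner (N x) (N x) = cinner (cadjoint N x) (cadjoint N x)" for x
    by (simp add: cinner_cadjoint[OF N] cinner_cadjoint_left[OF N])
  then show ?thesis unfolding op_ker_def by (metis cinner_eq_zero_iff)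
qed

lemma op_ker_cadjoint_subset_if_power_quasinormal_op:
  fixes T :: "'a::chilbert_space \<Rightarrow> 'a"
  assumes fd: "finite_dimensional_vector_space (scaleC :: complex \<Rightarrow> 'a \<Rightarrow> 'a) B"
    and T: "bounded_clinear T" and n: "n \<ge> 1" and pq: "power_quasinormal_op n T"
  shows "op_ker (cadjoint T ^^ n) \<subseteq> op_ker (T ^^ n)"
proof -
  define N where "N = T ^^ n"
  define M where "M = cadjoint N"
  define S where "S = cadjoint T"
  have N: "bounded_clinear N" unfolding N_def by (rule bounded_clinear_funpow[OF T])
  have M: "bounded_clinear M" unfolding M_def by (rule bounded_clinear_cadjoint[OF N])
  have S: "bounded_clinear S" unfolding S_def by (rule bounded_clinear_cadjoint[OF T])
  note adj = cinner_cadjoint[OF N, folded M_def] cinner_cadjoint_left[OF N, folded M_def]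
    cinner_cadjoint[OF T, folded S_def] cinner_cadjoint_left[OF T, folded S_def]
  have M_pow: "M = S ^^ n" by (simp add: M_def N_def S_def cadjoint_funpow[OF T])
  have NT: "N (T x) = T (N x)" for x by (simp add: N_def funpow_swap1)
  have NS: "N (S (T x)) = S (N (T x))" for x
    using power_quasinormal_op_commute[OF pq] by (simp add: N_def S_def)
  have NSN: "N (S (N x)) = S (N (N x))" for x
    using NS[of "(T ^^ (n - 1)) x"] n by (cases n) (auto simp: N_def)
  have N0: "N x = 0" if "T x = 0" for x
    using that n bounded_clinear_zero[OF bounded_clinear_funpow[OF T]]
    by (cases n) (auto simp: N_def funpow_swap1)
  have MST: "M (S (T x)) = S (T (M x))" for x
    by (rule cinner_right_unique) (metis adj NS NT)
  \<comment> \<open>The kernel of \<open>T\<close>, being that of \<open>S T\<close>, is invariant under \<open>M\<close>, which commutes with \<open>S T\<close>; as \<open>N\<close> vanishes on it, so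
    does \<open>M\<close>. Thus the range of \<open>N\<close> is orthogonal to the kernel of \<open>T\<close>.\<close>
  have M0: "M v = 0" if v: "T v = 0" for v
  proof -
    have "S (T (M v)) = 0"
      using MST[of v] v by (simp add: bounded_clinear_zero[OF S] bounded_clinear_zero[OF M])
    then have "cinner (T (M v)) (T (M v)) = 0" by (simp add: adj(3) cinner_zero)
    then have "T (M v) = 0" by (simp add: cinner_eq_zero_iff)
    then have "N (M v) = 0" by (rule N0)
    then have "cinner (M v) (M v) = 0" by (simp add: adj(2) cinner_zero)
    then show ?thesis by (simp add: cinner_eq_zero_iff)
  qed
  have inj: "N z = 0" if "T (N z) = 0" for z
  proof -
    have "M (N z) = 0" using that by (rule M0)
    then have "cinner (N z) (N z) = 0" by (simp add: adj(1) cinner_zero)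
    then show ?thesis by (simp add: cinner_eq_zero_iff)
  qed
  have injpow: "N z = 0" if "(T ^^ j) (N z) = 0" for j z
    using that
  proof (induction j arbitrary: z)
    case (Suc j)
    then have "(T ^^ j) (N (T z)) = 0" by (simp add: NT funpow_swap1)
    then have "N (T z) = 0" by (rule Suc.IH)
    then show ?case using inj[of z] NT[of z] by simp
  qed simp
  have ker_square: "N z = 0" if "N (N z) = 0" for z
    using injpow[of n z] that unfolding N_def by blast
  have square: "\<exists>z. N x = N (N z)" for x
    by (rule range_subset_range_square[OF fd])
      (auto simp: bounded_clinearD[OF N] intro: ker_square)
  have S_range: "\<exists>w. S (N x) = N w" for x
    using square[of x] NSN by metis
  have Sj_range: "\<exists>w. (S ^^ j) (N x) = N w" for j x
  proof (induction j)
    case (Suc j)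
    then show ?case using S_range by (metis comp_apply funpow.simps(2))
  qed auto
  have "N x = 0" if x: "M x = 0" for x
  proof -
    obtain w where "M (N x) = N w" using Sj_range M_pow by blast
    then have "cinner (N x) (N x) = cinner (M x) w" by (simp add: adj(1,2))
    also have "\<dots> = 0" using x by (simp add: cinner_zero)
    finally show ?thesis by (simp add: cinner_eq_zero_iff)
  qed
  then show ?thesis by (auto simp: op_ker_def M_pow S_def N_def)
qed

theorem theorem2p10:
  fixes T :: "'a::chilbert_space \<Rightarrow> 'a" and n :: nat
  assumes "bounded_clinear T" and "n \<ge> 1"
  shows "(normal_op (T ^^ n) \<longrightarrow> quasinormal_op (T ^^ n) \<and> power_quasinormal_op n T) \<and>
    (op_ker (cadjoint T ^^ n) \<subseteq> op_ker (T ^^ n) \<longrightarrow>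
      (normal_op (T ^^ n) \<longleftrightarrow> quasinormal_op (T ^^ n)) \<and>
      (quasinormal_op (T ^^ n) \<longleftrightarrow> power_quasinormal_op n T)) \<and>
    ((\<exists>B. finite_dimensional_vector_space (scaleC :: complex \<Rightarrow> 'a \<Rightarrow> 'a) B) \<longrightarrow>
      normal_op (T ^^ n) \<or> quasinormal_op (T ^^ n) \<or> power_quasinormal_op n T \<longrightarrow>
      op_ker (cadjoint T ^^ n) \<subseteq> op_ker (T ^^ n))"
proof -
  have N: "bounded_clinear (T ^^ n)" by (rule bounded_clinear_funpow[OF assms(1)])
  note adj = cadjoint_funpow[OF assms(1), of n]
  have i_ii: "quasinormal_op (T ^^ n)" if "normal_op (T ^^ n)"
    using that by (rule normal_op_imp_quasinormal_op)
  have i_iii: "power_quasinormal_op n T" if "normal_op (T ^^ n)"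
    using assms(1) that by (rule power_quasinormal_op_if_normal_op_funpow)
  have ii_i: "normal_op (T ^^ n)"
    if "op_ker (cadjoint T ^^ n) \<subseteq> op_ker (T ^^ n)" "quasinormal_op (T ^^ n)"
    using normal_op_if_quasinormal_op[OF N] that by (simp add: adj)
  have iii_i: "normal_op (T ^^ n)"
    if "op_ker (cadjoint T ^^ n) \<subseteq> op_ker (T ^^ n)" "power_quasinormal_op n T"
    using normal_op_funpow_if_power_quasinormal_op[OF assms that] .
  have fin: "op_ker (cadjoint T ^^ n) \<subseteq> op_ker (T ^^ n)"
    if fd: "finite_dimensional_vector_space (scaleC :: complex \<Rightarrow> 'a \<Rightarrow> 'a) B"
      and "normal_op (T ^^ n) \<or> quasinormal_op (T ^^ n) \<or> power_quasinormal_op n T" for B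
    using that(2)
  proof (elim disjE)
    assume "normal_op (T ^^ n)"
    then show ?thesis using op_ker_cadjoint_eq_if_normal_op[OF N] by (simp add: adj)
  next
    assume "quasinormal_op (T ^^ n)"
    then have "power_quasinormal_op 1 (T ^^ n)"
      by (simp add: quasinormal_op_def power_quasinormal_op_def)
    then show ?thesis
      using op_ker_cadjoint_subset_if_power_quasinormal_op[OF fd N, of 1] by (simp add: adj)
  next
    assume "power_quasinormal_op n T"
    then show ?thesis by (rule op_ker_cadjoint_subset_if_power_quasinormal_op[OF fd assms])
  qed
  show ?thesis using i_ii i_iii ii_i iii_i fin by blast
qed

end
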